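(* Let $D\subset\mathbb{C}$ be a simply connected domain and let $f=h\overline g$ be a non-vanishing sense-preserving logharmonic mapping in $D$ with dilatation $\omega$. For any $z_0\in D$, $$P_f(z_0)=P(h^ag^b)(z_0),$$ where $$a=\frac{1+\omega(z_0)}{1-|\omega(z_0)|^2}\quad\text{and}\quad b=-\overline{\omega(z_0)}\left[\frac{1+\omega(z_0)}{1-|\omega(z_0)|^2}\right].$$
   Context: A non-vanishing sense-preserving (locally univalent) logharmonic mapping $f=h\overline{g}$ on a domain: $h,g$ are non-vanishing analytic functions there, $h'$ does not vanish, and the (second complex) dilatation $\omega=\dfrac{g'h}{gh'}$ satisfies $|\omega|<1$ everywhere. Its pre-Schwarzian derivative is $$P_f=\frac{h''}{h'}+\omega\frac{h'}{h}-\frac{\omega'\overline{\omega}}{1-|\omega|^2}.$$ For an analytic function $\psi$ with $\psi'(z_0)\neq0$, $P\psi(z_0)=\psi''(z_0)/\psi'(z_0)$. The numbers $a,b$ are constants depending on $z_0$, and $h^a g^b$ denotes the analytic function $e^{a\log h+b\log g}$, where $\log h$, $\log g$ are any fixed holomorphic branches on $D$; the value of $P(h^ag^b)(z_0)$ does not depend on the choice of branches. *)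

theory Defs
  imports "HOL-Complex_Analysis.Complex_Analysis"
begin

definition dilatation :: "(complex \<Rightarrow> complex) \<Rightarrow> (complex \<Rightarrow> complex) \<Rightarrow> complex \<Rightarrow> complex" where
  "dilatation h g z = deriv g z * h z / (g z * deriv h z)"

definition sense_preserving_logharmonic_on ::
  "complex set \<Rightarrow> (complex \<Rightarrow> complex) \<Rightarrow> (complex \<Rightarrow> complex) \<Rightarrow> (complex \<Rightarrow> complex) \<Rightarrow> bool" where
  "sense_preserving_logharmonic_on D f h g \<longleftrightarrow>
     h holomorphic_on D \<and> g holomorphic_on D \<and>
     (\<forall>z\<in>D. h z \<noteq> 0) \<and> (\<forall>z\<in>D. g z \<noteq> 0) \<and> (\<forall>z\<in>D. deriv h z \<noteq> 0) \<and>
     (\<forall>z\<in>D. cmod (dilatation h g z) < 1) \<and>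
     (\<forall>z\<in>D. f z = h z * cnj (g z))"

(* The pre-Schwarzian derivative of the mapping h * cnj g, written in terms of its factors;
   it is unchanged when (h, g) is replaced by (c * h, g / cnj c) with c nonzero. *)
definition logharmonic_pre_schwarzian ::
  "(complex \<Rightarrow> complex) \<Rightarrow> (complex \<Rightarrow> complex) \<Rightarrow> complex \<Rightarrow> complex" where
  "logharmonic_pre_schwarzian h g z =
     deriv (deriv h) z / deriv h z
     + dilatation h g z * (deriv h z / h z)
     - deriv (dilatation h g) z * cnj (dilatation h g z)
         / (1 - of_real ((cmod (dilatation h g z))\<^sup>2))"

(* Meaningful only where deriv \<psi> z is nonzero. *)
definition pre_schwarzian :: "(complex \<Rightarrow> complex) \<Rightarrow> complex \<Rightarrow> complex" where
  "pre_schwarzian \<psi> z = deriv (deriv \<psi>) z / deriv \<psi> z"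

definition log_branch_on :: "complex set \<Rightarrow> (complex \<Rightarrow> complex) \<Rightarrow> (complex \<Rightarrow> complex) \<Rightarrow> bool" where
  "log_branch_on D u L \<longleftrightarrow> L holomorphic_on D \<and> (\<forall>z\<in>D. exp (L z) = u z)"

end

theory Submission
  imports Defs
begin

text \<open>With \<open>H = h' / h\<close> one has \<open>g' / g = \<omega> H\<close>, so the derivative of \<open>\<psi> = h\<^sup>a g\<^sup>b\<close> factors as
  \<open>\<psi>' = \<psi> H (a + b \<omega>)\<close> and \<open>P\<psi> = H (a + b \<omega>) + H' / H + b \<omega>' / (a + b \<omega>)\<close>. The constants are
  chosen so that \<open>a + b \<omega>(z\<^sub>0) = 1 + \<omega>(z\<^sub>0)\<close>, while \<open>H' / H = h'' / h' - H\<close>.\<close>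

lemma simply_connected_imp_log_branch:
  assumes "open D" "simply_connected D" "u holomorphic_on D" "\<And>z. z \<in> D \<Longrightarrow> u z \<noteq> 0"
  shows "\<exists>L. log_branch_on D u L"
  using assms simply_connected_eq_holomorphic_log[of D]
  unfolding log_branch_on_def by metis

text \<open>Differentiating \<open>exp (L w) = u w\<close> gives
  \<open>u z * deriv L z = deriv u z\<close>, and \<open>u z\<close> is nonzero as a value of
  \<open>exp\<close>. Hence all branches share one derivative, which is why the choice of branches
  cannot affect the pre-Schwarzian.\<close>

lemma log_branch_has_field_derivative:
  assumes "open D" "log_branch_on D u L" "z \<in> D"
  shows "(L has_field_derivative deriv u z / u z) (at z)"
proof -
  have L: "L holomorphic_on D" and eq: "\<And>w. w \<in> D \<Longrightarrow> exp (L w) = u w"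
    using assms(2) by (auto simp: log_branch_on_def)
  have dL: "(L has_field_derivative deriv L z) (at z)"
    using L assms(1,3) by (rule holomorphic_derivI)
  have "((\<lambda>w. exp (L w)) has_field_derivative exp (L z) * deriv L z) (at z)"
    by (auto intro!: derivative_eq_intros dL)
  then have "(u has_field_derivative exp (L z) * deriv L z) (at z)"
    by (rule has_field_derivative_transform_within_open[OF _ assms(1,3)]) (simp add: eq)
  then have "deriv u z = u z * deriv L z"
    using eq[OF assms(3)] DERIV_imp_deriv by fastforce
  moreover have "u z \<noteq> 0"
    using eq[OF assms(3)] exp_not_eq_zero by metis
  ultimately show ?thesis
    using dL by simp
qed

text \<open>This is the logarithmic derivative of the factorization of \<psi>', for arbitrary
  constants \<open>a\<close> and \<open>b\<close>. Since \<psi> and h'/h have no zeros in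
  \<open>D\<close>, the assumption on \<open>a + b * dilatation h g z0\<close> says exactly that
  \<psi>' does not vanish at \<open>z0\<close>.\<close>

lemma pre_schwarzian_exp_log_branches:
  assumes "open D" and "z0 \<in> D"
    and h: "h holomorphic_on D" and g: "g holomorphic_on D"
    and h0: "\<And>z. z \<in> D \<Longrightarrow> h z \<noteq> 0" and g0: "\<And>z. z \<in> D \<Longrightarrow> g z \<noteq> 0"
    and dh0: "\<And>z. z \<in> D \<Longrightarrow> deriv h z \<noteq> 0"
    and Lh: "log_branch_on D h Lh" and Lg: "log_branch_on D g Lg"
    and ab: "a + b * dilatation h g z0 \<noteq> 0"
  defines "\<psi> \<equiv> \<lambda>z. exp (a * Lh z + b * Lg z)"
  shows "deriv \<psi> z0 \<noteq> 0"
    and "pre_schwarzian \<psi> z0 = deriv (deriv h) z0 / deriv h z0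
           + (a + b * dilatation h g z0 - 1) * (deriv h z0 / h z0)
           + b * deriv (dilatation h g) z0 / (a + b * dilatation h g z0)"
proof -
  define \<omega> where "\<omega> = dilatation h g"
  define H where "H z = deriv h z / h z" for z
  \<comment> \<open>The formula is proved on all of \<open>D\<close>, not just at \<open>z0\<close>,
    because it is differentiated once more below.\<close>
  have d\<psi>: "(\<psi> has_field_derivative \<psi> z * (H z * (a + b * \<omega> z))) (at z)" if "z \<in> D" for z
  proof -
    have "(\<psi> has_field_derivative \<psi> z * (a * H z + b * (deriv g z / g z))) (at z)"
      unfolding \<psi>_def H_def
      by (auto intro!: derivative_eq_intros log_branch_has_field_derivative[OF \<open>open D\<close> Lh that]
          log_branch_has_field_derivative[OF \<open>open D\<close> Lg that]
          simp: mult.commute)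
    also have "a * H z + b * (deriv g z / g z) = H z * (a + b * \<omega> z)"
      using h0[OF that] g0[OF that] dh0[OF that]
      by (simp add: H_def \<omega>_def dilatation_def distrib_left ac_simps)
    finally show ?thesis .
  qed
  have \<psi>0: "\<psi> z0 \<noteq> 0" and H0: "H z0 \<noteq> 0"
    using h0 dh0 \<open>z0 \<in> D\<close> by (auto simp: \<psi>_def H_def)
  have deriv_\<psi>: "deriv \<psi> z = \<psi> z * (H z * (a + b * \<omega> z))" if "z \<in> D" for z
    using d\<psi>[OF that] by (rule DERIV_imp_deriv)
  show "deriv \<psi> z0 \<noteq> 0"
    using ab \<psi>0 H0 by (simp add: deriv_\<psi> \<open>z0 \<in> D\<close> \<omega>_def)

  have "\<omega> holomorphic_on D"
    unfolding \<omega>_def dilatation_def using h g h0 g0 dh0 \<open>open D\<close>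
    by (intro holomorphic_intros) auto
  then have d\<omega>: "(\<omega> has_field_derivative deriv \<omega> z0) (at z0)"
    using \<open>open D\<close> \<open>z0 \<in> D\<close> by (rule holomorphic_derivI)
  have dh: "(h has_field_derivative deriv h z0) (at z0)"
    using h \<open>open D\<close> \<open>z0 \<in> D\<close> by (rule holomorphic_derivI)
  have ddh: "(deriv h has_field_derivative deriv (deriv h) z0) (at z0)"
    using holomorphic_deriv[OF h \<open>open D\<close>] \<open>open D\<close> \<open>z0 \<in> D\<close> by (rule holomorphic_derivI)
  \<comment> \<open>The derivative is written as a multiple of \<open>H z0\<close> so that this
    factor cancels in the quotient \<psi>''/\<psi>'.\<close>
  have dH: "(H has_field_derivative H z0 * (deriv (deriv h) z0 / deriv h z0 - H z0)) (at z0)"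
    unfolding H_def using h0 dh0 \<open>z0 \<in> D\<close>
    by (auto intro!: derivative_eq_intros dh ddh simp: field_simps)
  have "((\<lambda>z. \<psi> z * (H z * (a + b * \<omega> z))) has_field_derivative
          \<psi> z0 * (H z0 * (a + b * \<omega> z0)) * (H z0 * (a + b * \<omega> z0))
          + \<psi> z0 * (H z0 * (deriv (deriv h) z0 / deriv h z0 - H z0) * (a + b * \<omega> z0)
                     + H z0 * (b * deriv \<omega> z0))) (at z0)"
    by (auto intro!: derivative_eq_intros d\<psi> dH d\<omega> \<open>z0 \<in> D\<close> simp: algebra_simps add_divide_distrib)
  \<comment> \<open>The product agrees with \<open>deriv \<psi>\<close> only on \<open>D\<close>; as
    \<open>D\<close> is an open neighbourhood of \<open>z0\<close>, the derivatives at
    \<open>z0\<close> coincide.\<close>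
  then have dd\<psi>: "deriv (deriv \<psi>) z0 =
          \<psi> z0 * (H z0 * (a + b * \<omega> z0)) * (H z0 * (a + b * \<omega> z0))
          + \<psi> z0 * (H z0 * (deriv (deriv h) z0 / deriv h z0 - H z0) * (a + b * \<omega> z0)
                     + H z0 * (b * deriv \<omega> z0))"
    by (intro DERIV_imp_deriv)
      (rule has_field_derivative_transform_within_open[OF _ \<open>open D\<close> \<open>z0 \<in> D\<close>], auto simp: deriv_\<psi>)
  \<comment> \<open>The quotient \<psi>''/\<psi>' as a pure field identity: \<open>p\<close>,
    \<open>k\<close>, \<open>c\<close> stand for the values of \<psi>, \<open>H\<close> and
    \<open>a + b * \<omega>\<close> at \<open>z0\<close>, while \<open>q\<close> is h''/h' and
    \<open>e\<close> is b \<omega>'.\<close>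
  have cancel: "(p * (k * c) * (k * c) + p * (k * (q - k) * c + k * e)) / (p * (k * c))
      = q + (c - 1) * k + e / c" if "p \<noteq> 0" "k \<noteq> 0" "c \<noteq> 0" for p k c q e :: complex
    using that by (simp add: field_simps)
  show "pre_schwarzian \<psi> z0 = deriv (deriv h) z0 / deriv h z0
           + (a + b * dilatation h g z0 - 1) * (deriv h z0 / h z0)
           + b * deriv (dilatation h g) z0 / (a + b * dilatation h g z0)"
    using cancel[OF \<psi>0 H0, of "a + b * \<omega> z0"] ab
    by (simp add: pre_schwarzian_def dd\<psi> deriv_\<psi> \<open>z0 \<in> D\<close> flip: H_def \<omega>_def)
qed

theorem theorem1:
  fixes D :: "complex set" and f h g :: "complex \<Rightarrow> complex" and z0 a b :: complex
  assumes "open D" and "connected D" and "simply_connected D"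
    and "sense_preserving_logharmonic_on D f h g"
    and "z0 \<in> D"
    and "a = (1 + dilatation h g z0) / (1 - of_real ((cmod (dilatation h g z0))\<^sup>2))"
    and "b = - cnj (dilatation h g z0) *
               ((1 + dilatation h g z0) / (1 - of_real ((cmod (dilatation h g z0))\<^sup>2)))"
  shows "(\<exists>Lh. log_branch_on D h Lh) \<and> (\<exists>Lg. log_branch_on D g Lg) \<and>
    (\<forall>Lh Lg. log_branch_on D h Lh \<longrightarrow> log_branch_on D g Lg \<longrightarrow>
       deriv (\<lambda>z. exp (a * Lh z + b * Lg z)) z0 \<noteq> 0 \<and>
       logharmonic_pre_schwarzian h g z0 = pre_schwarzian (\<lambda>z. exp (a * Lh z + b * Lg z)) z0)"
proof -
  define w where "w = dilatation h g z0"
  define d :: complex where "d = 1 - of_real ((cmod w)\<^sup>2)"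
  have h: "h holomorphic_on D" and g: "g holomorphic_on D"
    and h0: "\<And>z. z \<in> D \<Longrightarrow> h z \<noteq> 0" and g0: "\<And>z. z \<in> D \<Longrightarrow> g z \<noteq> 0"
    and dh0: "\<And>z. z \<in> D \<Longrightarrow> deriv h z \<noteq> 0" and w1: "cmod w < 1"
    using assms(4,5) by (auto simp: sense_preserving_logharmonic_on_def w_def)
  have "(cmod w)\<^sup>2 < 1"
    using w1 by (simp add: power_less_one_iff)
  then have d0: "d \<noteq> 0"
    unfolding d_def by (metis eq_iff_diff_eq_0 less_irrefl of_real_eq_1_iff)
  \<comment> \<open>\<open>1 + w\<close> will be the value of \<open>a + b * w\<close>, so this
    gives the non-vanishing of \<psi>' at \<open>z0\<close>.\<close>
  have w0: "1 + w \<noteq> 0"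
    using w1 by (metis add_eq_0_iff less_irrefl norm_minus_cancel norm_one)
  have a: "a = (1 + w) / d"
    using assms(6) by (simp add: w_def d_def)
  have b: "b = - cnj w * ((1 + w) / d)"
    using assms(7) by (simp add: w_def d_def)
  \<comment> \<open>As \<open>b\<close> equals \<open>- cnj w * a\<close>, the sum is
    \<open>a * (1 - w * cnj w)\<close>, and the second factor is the denominator \<open>d\<close> of
    \<open>a\<close>.\<close>
  have "a + b * w = (1 + w) / d * (1 - w * cnj w)"
    using d0 by (simp add: a b field_simps)
  also have "1 - w * cnj w = d"
    by (simp add: d_def complex_norm_square del: of_real_power)
  finally have abw: "a + b * w = 1 + w"
    using d0 by simp
  have "deriv (\<lambda>z. exp (a * Lh z + b * Lg z)) z0 \<noteq> 0 \<and>
       logharmonic_pre_schwarzian h g z0 = pre_schwarzian (\<lambda>z. exp (a * Lh z + b * Lg z)) z0"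
    if "log_branch_on D h Lh" "log_branch_on D g Lg" for Lh Lg
  proof -
    have ab: "a + b * dilatation h g z0 \<noteq> 0"
      using abw w0 by (simp add: w_def)
    note P = pre_schwarzian_exp_log_branches[OF assms(1,5) h g h0 g0 dh0 that ab]
    \<comment> \<open>The factor \<open>1 + w\<close> of \<open>b\<close> cancels; with
      \<omega>'(z0) for \<open>e\<close> this is the last term of P_f. The middle term matches
      because \<open>a + b * w - 1 = w\<close>.\<close>
    have "b * e / (1 + w) = - (e * cnj w / d)" for e
      using w0 by (simp add: b)
    then show ?thesis
      using P abw by (simp add: logharmonic_pre_schwarzian_def flip: w_def d_def
          del: of_real_power)
  qed
  moreover have "\<exists>Lh. log_branch_on D h Lh" "\<exists>Lg. log_branch_on D g Lg"
    using simply_connected_imp_log_branch assms(1,3) h g h0 g0 by blast+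
  ultimately show ?thesis
    by blast
qed

end
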